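(* Consider the non-atomic routing game $(\mathcal G,\Phi)$ on a parallel network under Assumptions A1 (unique bottleneck on each route), A2 ($\Phi\le\sum_{p=1}^N\overline z_p$) and A3 (distinct $\tau_p^F$ ordered increasingly, distinct $\tau_p^S$). Let $k:=\min\{p\in\{1,\dots,N\}:\Phi-\sum_{i=1}^p\overline z_i\le0\}$. Then the game admits a unique social optimum $(R^O,x^O)$, given by $$\Phi R^O=\Bigl(\overline z_1,\dots,\overline z_{k-1},\ \Phi-\sum_{p=1}^{k-1}\overline z_p,\ 0,\dots,0\Bigr),$$ $$x_p^O=\Bigl(\frac{\overline z_p}{v_{1_p}},\dots,\frac{\overline z_p}{v_{n_p}}\Bigr)\ (p=1,\dots,k-1),\qquad x_k^O=\Bigl(\frac{\Phi-\sum_{p=1}^{k-1}\overline z_p}{v_{1_k}},\dots,\frac{\Phi-\sum_{p=1}^{k-1}\overline z_p}{v_{n_k}}\Bigr),$$ and $x_p^O=0$ for $p>k$.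
   Context: Network. A parallel network $\mathcal G$ has $N\ge1$ link-disjoint routes $p=1,\dots,N$ from a single origin to a single destination; route $p$ is a sequence of links $1_p,2_p,\dots,n_p$ ($n_p\ge1$). Each link $l$ has positive constants $\overline x_l$ (jam density), $\overline f_l$ (capacity), $v_l$ (free-flow speed), $L_l$ (length). Set $x_l^c:=\overline f_l/v_l$ (critical density), assumed $<\overline x_l$, and $w_l:=\overline f_l/(\overline x_l-x_l^c)$. Supply and demand functions: $s_l(x_l)=\min\{\overline f_l,w_l(\overline x_l-x_l)\}$, $d_l(x_l)=\min\{v_lx_l,\overline f_l\}$. The exogenous flow is a constant $\Phi>0$. Flows. A routing vector is $R\in\mathbb R_{\ge0}^N$ with $\sum_pR_p=1$. A density vector is $x=(x_p)_{p=1}^N$ with $x_p=(x_{1_p},\dots,x_{n_p})\in\mathbb R_{\ge0}^{n_p}$. Given $R$ and $x$, put $f_{0_p}(x)=\min\{\Phi R_p,s_{1_p}(x_{1_p})\}$, $f_{l_p}(x)=\min\{d_{l_p}(x_{l_p}),s_{(l+1)_p}(x_{(l+1)_p})\}$ for $1\le l\le n_p-1$, and $f_{n_p}(x)=d_{n_p}(x_{n_p})$. The density vector $x$ is consistent with $R$ if $f_{0_p}(x)=f_{1_p}(x)=\dots=f_{n_p}(x)$ for all $p$; $C(R)$ is the set of density vectors consistent with $R$. A traffic assignment is a pair $(R,x)$ with $R$ a routing vector and $x\in C(R)$. Route capacity: $\overline z_p:=\min_{l\in p}\overline f_l$. Assumption A1: for each route $p$, the minimum $\overline z_p$ is attained at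 a unique link $b_p$. Assumption A2: $\Phi\le\sum_{p=1}^N\overline z_p$. Travel times. For a traffic assignment $(R,x)$, link $l_p$ has travel time $\tau_{l_p}(x)=L_{l_p}x_{l_p}/f_{l_p}(x)$, with value $L_{l_p}/v_{l_p}$ if $x_{l_p}=0$; route $p$ has travel time $\tau_p(x)=\sum_{l\in p}\tau_l(x)$. Define $\tau_p^F:=\sum_{l\in p}L_l/v_l$ and $\tau_p^S:=\sum_{l=1_p}^{(b-1)_p}\frac{L_l}{\overline z_p}(\overline x_l-\overline z_p/w_l)+\sum_{l=b_p}^{n_p}L_l/v_l$. Assumption A3: $\tau_1^F<\dots<\tau_N^F$, and $\tau_p^S\ne\tau_q^S$ for $p\ne q$. Social optimum of $(\mathcal G,\Phi)$: a traffic assignment $(R^O,x^O)$ minimizing $\sum_{p=1}^N\Phi R_p\tau_p(x)$ over all pairs $(R,x)$ with $R$ a routing vector, $x\in C(R)$, and $\Phi R_p\le\overline z_p$ for all $p$. *)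

theory Defs
  imports Complex_Main "HOL-Library.FuncSet"
begin

text \<open>
  Routes are numbered \<open>1, \<dots>, n_routes G\<close>, and the \<open>l\<close>-th link of route \<open>p\<close> is addressed by
  the pair \<open>p l\<close> with \<open>1 \<le> l \<le> n_links G p\<close>. Routes are therefore link-disjoint by
  construction. Values of the fields outside these ranges are irrelevant.
\<close>

record network =
  n_routes :: nat
  n_links :: "nat \<Rightarrow> nat"
  jam_density :: "nat \<Rightarrow> nat \<Rightarrow> real"
  capacity :: "nat \<Rightarrow> nat \<Rightarrow> real"
  free_speed :: "nat \<Rightarrow> nat \<Rightarrow> real"
  link_length :: "nat \<Rightarrow> nat \<Rightarrow> real"

definition routes :: "network \<Rightarrow> nat set" where
  "routes G = {1..n_routes G}"

definition links :: "network \<Rightarrow> nat \<Rightarrow> nat set" where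
  "links G p = {1..n_links G p}"

definition critical_density :: "network \<Rightarrow> nat \<Rightarrow> nat \<Rightarrow> real" where
  "critical_density G p l = capacity G p l / free_speed G p l"

definition wave_speed :: "network \<Rightarrow> nat \<Rightarrow> nat \<Rightarrow> real" where
  "wave_speed G p l = capacity G p l / (jam_density G p l - critical_density G p l)"

definition parallel_network :: "network \<Rightarrow> bool" where
  "parallel_network G \<longleftrightarrow>
     n_routes G \<ge> 1 \<and>
     (\<forall>p\<in>routes G. n_links G p \<ge> 1 \<and>
       (\<forall>l\<in>links G p.
          jam_density G p l > 0 \<and> capacity G p l > 0 \<and>
          free_speed G p l > 0 \<and> link_length G p l > 0 \<and>
          critical_density G p l < jam_density G p l))"

definition link_supply :: "network \<Rightarrow> nat \<Rightarrow> nat \<Rightarrow> real \<Rightarrow> real" where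
  "link_supply G p l y = min (capacity G p l) (wave_speed G p l * (jam_density G p l - y))"

definition link_demand :: "network \<Rightarrow> nat \<Rightarrow> nat \<Rightarrow> real \<Rightarrow> real" where
  "link_demand G p l y = min (free_speed G p l * y) (capacity G p l)"

text \<open>
  Vectors are extensional functions, i.e. they take the fixed value \<open>undefined\<close> outside their
  index set, so that equality of such functions is equality of vectors.
\<close>

definition routing_vectors :: "network \<Rightarrow> (nat \<Rightarrow> real) set" where
  "routing_vectors G = {R \<in> routes G \<rightarrow>\<^sub>E {0..}. (\<Sum>p\<in>routes G. R p) = 1}"

definition density_vectors :: "network \<Rightarrow> (nat \<Rightarrow> nat \<Rightarrow> real) set" where
  "density_vectors G = (\<Pi>\<^sub>E p\<in>routes G. links G p \<rightarrow>\<^sub>E {0..})"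

definition flow ::
  "network \<Rightarrow> real \<Rightarrow> (nat \<Rightarrow> real) \<Rightarrow> (nat \<Rightarrow> nat \<Rightarrow> real) \<Rightarrow> nat \<Rightarrow> nat \<Rightarrow> real" where
  "flow G \<Phi> R x p l =
     (if l = 0 then min (\<Phi> * R p) (link_supply G p 1 (x p 1))
      else if l < n_links G p
      then min (link_demand G p l (x p l)) (link_supply G p (l + 1) (x p (l + 1)))
      else link_demand G p l (x p l))"

definition consistent :: "network \<Rightarrow> real \<Rightarrow> (nat \<Rightarrow> real) \<Rightarrow> (nat \<Rightarrow> nat \<Rightarrow> real) set" where
  "consistent G \<Phi> R =
     {x \<in> density_vectors G.
        \<forall>p\<in>routes G. \<forall>l\<in>links G p. flow G \<Phi> R x p l = flow G \<Phi> R x p 0}"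

definition traffic_assignments ::
  "network \<Rightarrow> real \<Rightarrow> ((nat \<Rightarrow> real) \<times> (nat \<Rightarrow> nat \<Rightarrow> real)) set" where
  "traffic_assignments G \<Phi> = (SIGMA R:routing_vectors G. consistent G \<Phi> R)"

definition route_capacity :: "network \<Rightarrow> nat \<Rightarrow> real" where
  "route_capacity G p = Min (capacity G p ` links G p)"

definition is_bottleneck :: "network \<Rightarrow> nat \<Rightarrow> nat \<Rightarrow> bool" where
  "is_bottleneck G p l \<longleftrightarrow> l \<in> links G p \<and> capacity G p l = route_capacity G p"

definition bottleneck :: "network \<Rightarrow> nat \<Rightarrow> nat" where
  "bottleneck G p = (THE l. is_bottleneck G p l)"

definition link_time ::
  "network \<Rightarrow> real \<Rightarrow> (nat \<Rightarrow> real) \<Rightarrow> (nat \<Rightarrow> nat \<Rightarrow> real) \<Rightarrow> nat \<Rightarrow> nat \<Rightarrow> real" where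
  "link_time G \<Phi> R x p l =
     (if x p l = 0 then link_length G p l / free_speed G p l
      else link_length G p l * x p l / flow G \<Phi> R x p l)"

definition route_time ::
  "network \<Rightarrow> real \<Rightarrow> (nat \<Rightarrow> real) \<Rightarrow> (nat \<Rightarrow> nat \<Rightarrow> real) \<Rightarrow> nat \<Rightarrow> real" where
  "route_time G \<Phi> R x p = (\<Sum>l\<in>links G p. link_time G \<Phi> R x p l)"

definition free_flow_time :: "network \<Rightarrow> nat \<Rightarrow> real" where
  "free_flow_time G p = (\<Sum>l\<in>links G p. link_length G p l / free_speed G p l)"

definition saturated_time :: "network \<Rightarrow> nat \<Rightarrow> real" where
  "saturated_time G p =
     (\<Sum>l = 1..<bottleneck G p.
        link_length G p l / route_capacity G p *
        (jam_density G p l - route_capacity G p / wave_speed G p l)) +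
     (\<Sum>l = bottleneck G p..n_links G p. link_length G p l / free_speed G p l)"

definition unique_bottlenecks :: "network \<Rightarrow> bool" where
  "unique_bottlenecks G \<longleftrightarrow> (\<forall>p\<in>routes G. \<exists>!l. is_bottleneck G p l)"

definition feasible_demand :: "network \<Rightarrow> real \<Rightarrow> bool" where
  "feasible_demand G \<Phi> \<longleftrightarrow> \<Phi> \<le> (\<Sum>p\<in>routes G. route_capacity G p)"

definition distinct_times :: "network \<Rightarrow> bool" where
  "distinct_times G \<longleftrightarrow>
     strict_mono_on (routes G) (free_flow_time G) \<and>
     inj_on (saturated_time G) (routes G)"

definition social_cost ::
  "network \<Rightarrow> real \<Rightarrow> (nat \<Rightarrow> real) \<times> (nat \<Rightarrow> nat \<Rightarrow> real) \<Rightarrow> real" where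
  "social_cost G \<Phi> = (\<lambda>(R, x). \<Sum>p\<in>routes G. \<Phi> * R p * route_time G \<Phi> R x p)"

definition admissible_assignments ::
  "network \<Rightarrow> real \<Rightarrow> ((nat \<Rightarrow> real) \<times> (nat \<Rightarrow> nat \<Rightarrow> real)) set" where
  "admissible_assignments G \<Phi> =
     {(R, x) \<in> traffic_assignments G \<Phi>. \<forall>p\<in>routes G. \<Phi> * R p \<le> route_capacity G p}"

definition social_optimum ::
  "network \<Rightarrow> real \<Rightarrow> (nat \<Rightarrow> real) \<times> (nat \<Rightarrow> nat \<Rightarrow> real) \<Rightarrow> bool" where
  "social_optimum G \<Phi> = is_arg_min (social_cost G \<Phi>) (\<lambda>a. a \<in> admissible_assignments G \<Phi>)"

end

(*
  On an admissible assignment every link of route p carries exactly the flow \<Phi> R p: a smaller flow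
  would leave the first link congested, and congestion would propagate downstream to the last
  link, whose outflow is not restricted.  Since a flow never exceeds v x, each link takes
  at least its free-flow time, so the social cost is at least the sum of \<Phi> R p times the free-flow
  time of p, with equality only for the free-flow densities.  This lower bound is a linear program
  in \<Phi> R, solved uniquely by filling the routes greedily in the order of their free-flow times.
*)
theory Submission
  imports Defs
begin

section \<open>Constants of links and routes; supply and demand around the critical density\<close>

lemma link_facts:
  assumes "parallel_network G" "p \<in> routes G" "l \<in> links G p"
  shows "capacity G p l > 0" "free_speed G p l > 0" "link_length G p l > 0"
    "critical_density G p l < jam_density G p l" "route_capacity G p \<le> capacity G p l"
proof -
  show "capacity G p l > 0" "free_speed G p l > 0" "link_length G p l > 0"
    "critical_density G p l < jam_density G p l"
    using assms unfolding parallel_network_def by auto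
  show "route_capacity G p \<le> capacity G p l"
    unfolding route_capacity_def using assms(3) by (intro Min_le) (auto simp: links_def)
qed

lemma n_links_ge_1:
  assumes "parallel_network G" "p \<in> routes G"
  shows "n_links G p \<ge> 1"
  using assms unfolding parallel_network_def by auto

lemma route_capacity_pos:
  assumes "parallel_network G" "p \<in> routes G"
  shows "route_capacity G p > 0"
proof -
  have "1 \<in> links G p" using n_links_ge_1[OF assms] by (simp add: links_def)
  hence "route_capacity G p \<in> capacity G p ` links G p"
    unfolding route_capacity_def by (intro Min_in) (auto simp: links_def)
  thus ?thesis using link_facts(1)[OF assms] by auto
qed

text \<open>\<open>wave_speed\<close> is chosen so that the falling branch of the supply meets the
  capacity exactly at the critical density; at smaller densities that branch is no lower.\<close>

lemma link_supply_uncongested: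
  assumes "parallel_network G" "p \<in> routes G" "l \<in> links G p" "y \<le> critical_density G p l"
  shows "link_supply G p l y = capacity G p l"
proof -
  note lf = link_facts[OF assms(1-3)]
  have "wave_speed G p l * (jam_density G p l - critical_density G p l) = capacity G p l"
    unfolding wave_speed_def using lf(4) by simp
  moreover have "wave_speed G p l \<ge> 0"
    unfolding wave_speed_def using lf(1,4) by simp
  ultimately have "capacity G p l \<le> wave_speed G p l * (jam_density G p l - y)"
    using assms(4) by (metis diff_left_mono mult_left_mono)
  thus ?thesis unfolding link_supply_def by simp
qed

lemma link_demand_congested:
  assumes "parallel_network G" "p \<in> routes G" "l \<in> links G p" "critical_density G p l \<le> y"
  shows "link_demand G p l y = capacity G p l"
  using assms(4) link_facts(2)[OF assms(1-3)]
  unfolding link_demand_def critical_density_def by (simp add: field_simps)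

text \<open>The two sides of the critical density give the two cases. This is used as a dichotomy: a
  link whose supply is below capacity demands its full capacity.\<close>

lemma supply_or_demand_saturated:
  assumes "parallel_network G" "p \<in> routes G" "l \<in> links G p"
  shows "link_supply G p l y = capacity G p l \<or> link_demand G p l y = capacity G p l"
  using link_supply_uncongested[OF assms] link_demand_congested[OF assms] by (meson linear)

section \<open>Flows and densities of admissible assignments\<close>

lemma consistent_flow:
  assumes "x \<in> consistent G \<Phi> R" "p \<in> routes G" "l \<le> n_links G p"
  shows "flow G \<Phi> R x p l = flow G \<Phi> R x p 0"
  using assms unfolding consistent_def links_def by (cases "l = 0") auto

text \<open>A common flow \<open>f\<close> below \<open>\<Phi> * R p\<close> is below every capacity
  of the route. The entrance is then limited by the supply of link 1. A link with supply
  \<open>f\<close> demands its capacity, which exceeds \<open>f\<close>, so the next link must be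
  the limiting one.\<close>

lemma admissible_flow:
  assumes G: "parallel_network G" and x: "x \<in> consistent G \<Phi> R" and p: "p \<in> routes G"
    and le: "\<Phi> * R p \<le> route_capacity G p" and l: "l \<le> n_links G p"
  shows "flow G \<Phi> R x p l = \<Phi> * R p"
proof -
  define f where "f = flow G \<Phi> R x p 0"
  have fl: "flow G \<Phi> R x p m = f" if "m \<le> n_links G p" for m
    using consistent_flow[OF x p that] by (simp add: f_def)
  have "f \<le> \<Phi> * R p" unfolding f_def flow_def by simp
  moreover have "\<not> f < \<Phi> * R p"
  proof
    assume less: "f < \<Phi> * R p"
    have cap: "f < capacity G p m" if "m \<in> links G p" for m
      using less le link_facts(5)[OF G p that] by linarith
    have link_demand: "link_demand G p m (x p m) = capacity G p m"
      if "m \<in> links G p" "link_supply G p m (x p m) = f" for m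
      using supply_or_demand_saturated[OF G p that(1), of "x p m"] cap[OF that(1)] that(2) by auto
    have link_supply: "link_supply G p m (x p m) = f" if "1 \<le> m" "m \<le> n_links G p" for m
      using that
    proof (induction m rule: dec_induct)
      case base
      show ?case using fl[of 0] less unfolding flow_def by (auto simp: min_def split: if_splits)
    next
      case (step m)
      have m: "m \<in> links G p" using step by (simp add: links_def)
      have "min (link_demand G p m (x p m)) (link_supply G p (Suc m) (x p (Suc m))) = f"
        using fl[of m] step unfolding flow_def by simp
      moreover have "link_demand G p m (x p m) > f"
        using link_demand[OF m] cap[OF m] step by simp
      ultimately show ?case by (auto simp: min_def split: if_splits)
    qed
    \<comment> \<open>The outflow of the last link is its demand alone, yet this congested link
      demands more than \<open>f\<close>.\<close>
    let ?n = "n_links G p"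
    have n: "?n \<in> links G p" using n_links_ge_1[OF G p] by (simp add: links_def)
    have "link_demand G p ?n (x p ?n) = f"
      using fl[of ?n] n_links_ge_1[OF G p] unfolding flow_def by simp
    thus False using link_demand[OF n link_supply] cap[OF n] n_links_ge_1[OF G p] by simp
  qed
  ultimately show ?thesis using fl[OF l] by simp
qed

text \<open>The outflow of a link is at most its demand, hence at most speed times density.\<close>

lemma admissible_density_ge:
  assumes "parallel_network G" "x \<in> consistent G \<Phi> R" "p \<in> routes G"
    "\<Phi> * R p \<le> route_capacity G p" and l: "l \<in> links G p"
  shows "\<Phi> * R p / free_speed G p l \<le> x p l"
proof -
  have "\<Phi> * R p \<le> free_speed G p l * x p l"
    using admissible_flow[OF assms(1-4), of l] l
    unfolding flow_def link_demand_def links_def by (auto split: if_splits)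
  thus ?thesis using link_facts(2)[OF assms(1,3) l] by (simp add: field_simps)
qed

text \<open>The cost gives a route without flow weight 0 and so cannot see its densities; uniqueness
  needs this separate argument. The last link has zero demand, so it is empty. An empty link
  supplies its full positive capacity, so zero inflow forces the demand of the link before it to
  vanish.\<close>

lemma unused_route_density:
  assumes G: "parallel_network G" and x: "x \<in> consistent G \<Phi> R" and p: "p \<in> routes G"
    and R: "R p = 0" and l: "l \<in> links G p"
  shows "x p l = 0"
proof -
  have fl: "flow G \<Phi> R x p m = 0" if "m \<le> n_links G p" for m
    using admissible_flow[OF G x p _ that] R route_capacity_pos[OF G p] by simp
  have zero: "x p m = 0" if "m \<in> links G p" "link_demand G p m (x p m) = 0" for m
    using that link_facts[OF G p that(1)] unfolding link_demand_def
    by (auto simp: min_def split: if_splits)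
  have "l \<le> n_links G p" "1 \<le> l" using l by (auto simp: links_def)
  thus ?thesis
  \<comment> \<open>The induction runs upstream from the last link.\<close>
  proof (induction l rule: inc_induct)
    case base
    thus ?case using fl[of "n_links G p"] unfolding flow_def by (intro zero) (auto simp: links_def)
  next
    case (step m)
    have m: "m \<in> links G p" "Suc m \<in> links G p" using step by (auto simp: links_def)
    note lf = link_facts[OF G p m(2)]
    have "link_supply G p (Suc m) (x p (Suc m)) = capacity G p (Suc m)"
      using step lf by (intro link_supply_uncongested[OF G p m(2)]) (simp add: critical_density_def)
    moreover have "min (link_demand G p m (x p m)) (link_supply G p (Suc m) (x p (Suc m))) = 0"
      using fl[of m] step unfolding flow_def by simp
    ultimately show ?case using lf by (intro zero m) (auto simp: min_def split: if_splits)
  qed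
qed

section \<open>Travel times compared with free-flow times\<close>

text \<open>At the fixed positive flow \<open>\<Phi> * R p\<close> the travel time is proportional
  to the density, and the least possible density gives exactly the free-flow time.\<close>

lemma link_time_ge:
  assumes G: "parallel_network G" and x: "x \<in> consistent G \<Phi> R" and p: "p \<in> routes G"
    and le: "\<Phi> * R p \<le> route_capacity G p" and l: "l \<in> links G p" and pos: "\<Phi> * R p > 0"
  shows "link_length G p l / free_speed G p l \<le> link_time G \<Phi> R x p l"
    and "link_time G \<Phi> R x p l = link_length G p l / free_speed G p l \<Longrightarrow>
      x p l = \<Phi> * R p / free_speed G p l"
proof -
  note lf = link_facts[OF G p l]
  have ge: "\<Phi> * R p / free_speed G p l \<le> x p l" by (rule admissible_density_ge[OF G x p le l])
  have "\<Phi> * R p / free_speed G p l > 0" using pos lf by simp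
  \<comment> \<open>This excludes the default value of \<open>link_time\<close> at density
    0.\<close>
  hence "x p l > 0" using ge by linarith
  moreover have "flow G \<Phi> R x p l = \<Phi> * R p"
    using admissible_flow[OF G x p le] l by (simp add: links_def)
  ultimately have t: "link_time G \<Phi> R x p l = link_length G p l * x p l / (\<Phi> * R p)"
    unfolding link_time_def by simp
  show "link_length G p l / free_speed G p l \<le> link_time G \<Phi> R x p l"
  proof -
    have "link_length G p l / free_speed G p l
        = link_length G p l * (\<Phi> * R p / free_speed G p l) / (\<Phi> * R p)"
      using pos by auto
    also have "\<dots> \<le> link_time G \<Phi> R x p l"
      unfolding t using ge pos lf by (intro divide_right_mono mult_left_mono) auto
    finally show ?thesis .
  qed
  show "x p l = \<Phi> * R p / free_speed G p l"
    if "link_time G \<Phi> R x p l = link_length G p l / free_speed G p l"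
  proof -
    have "link_length G p l * (x p l * free_speed G p l) = link_length G p l * (\<Phi> * R p)"
      using that pos lf unfolding t by (subst (asm) frac_eq_eq) (auto simp: mult_ac)
    hence "x p l * free_speed G p l = \<Phi> * R p" using lf(3) by simp
    thus ?thesis using lf(2) by (simp add: eq_divide_eq)
  qed
qed

lemma route_cost_ge:
  assumes G: "parallel_network G" and x: "x \<in> consistent G \<Phi> R" and p: "p \<in> routes G"
    and le: "\<Phi> * R p \<le> route_capacity G p" and nonneg: "\<Phi> * R p \<ge> 0"
  shows "\<Phi> * R p * free_flow_time G p \<le> \<Phi> * R p * route_time G \<Phi> R x p"
proof (cases "\<Phi> * R p = 0")
  case False
  hence "\<Phi> * R p > 0" using nonneg by linarith
  thus ?thesis unfolding free_flow_time_def route_time_def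
    by (intro mult_left_mono sum_mono link_time_ge(1)[OF G x p le]) auto
qed auto

lemma route_cost_eqD:
  assumes G: "parallel_network G" and x: "x \<in> consistent G \<Phi> R" and p: "p \<in> routes G"
    and le: "\<Phi> * R p \<le> route_capacity G p" and nonneg: "R p \<ge> 0" and \<Phi>: "\<Phi> > 0"
    and eq: "\<Phi> * R p * route_time G \<Phi> R x p = \<Phi> * R p * free_flow_time G p"
    and l: "l \<in> links G p"
  shows "x p l = \<Phi> * R p / free_speed G p l"
proof (cases "R p = 0")
  case True
  thus ?thesis using unused_route_density[OF G x p True l] by simp
next
  case False
  hence pos: "\<Phi> * R p > 0" using nonneg \<Phi> by simp
  hence "(\<Sum>l\<in>links G p. link_length G p l / free_speed G p l)
      = (\<Sum>l\<in>links G p. link_time G \<Phi> R x p l)"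
    using eq pos unfolding route_time_def free_flow_time_def by auto
  hence "link_length G p l / free_speed G p l = link_time G \<Phi> R x p l"
    by (rule sum_mono_inv) (use link_time_ge(1)[OF G x p le _ pos] l in \<open>auto simp: links_def\<close>)
  thus ?thesis using link_time_ge(2)[OF G x p le l pos] by simp
qed

section \<open>Free-flow densities\<close>

text \<open>Both levels are restricted to their index sets, so that this is an extensional vector
  and equality with it can be proved.\<close>

definition free_density ::
  "network \<Rightarrow> real \<Rightarrow> (nat \<Rightarrow> real) \<Rightarrow> nat \<Rightarrow> nat \<Rightarrow> real" where
  "free_density G \<Phi> R = (\<lambda>p\<in>routes G. \<lambda>l\<in>links G p. \<Phi> * R p / free_speed G p l)"

text \<open>A flow within the route capacity keeps each density at most critical, so every demand
  equals the flow and every supply equals the capacity. Hence each minimum in \<open>flow\<close> is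
  the flow itself.\<close>

lemma free_density_flow:
  assumes G: "parallel_network G" and p: "p \<in> routes G" and le: "\<Phi> * R p \<le> route_capacity G p"
    and l: "l \<le> n_links G p"
  shows "flow G \<Phi> R (free_density G \<Phi> R) p l = \<Phi> * R p"
proof -
  let ?x = "free_density G \<Phi> R"
  have link_supply: "\<Phi> * R p \<le> link_supply G p m (?x p m)"
    and link_demand: "link_demand G p m (?x p m) = \<Phi> * R p" if m: "m \<in> links G p" for m
  proof -
    note lf = link_facts[OF G p m]
    have xm: "?x p m = \<Phi> * R p / free_speed G p m" using p m by (simp add: free_density_def)
    have "?x p m \<le> critical_density G p m"
      using lf le unfolding xm critical_density_def by (simp add: divide_right_mono)
    thus "\<Phi> * R p \<le> link_supply G p m (?x p m)"
      using link_supply_uncongested[OF G p m] le lf by simp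
    show "link_demand G p m (?x p m) = \<Phi> * R p"
      using lf le unfolding xm link_demand_def by simp
  qed
  show ?thesis
    using l n_links_ge_1[OF G p] link_supply[of 1] link_supply[of "Suc l"] link_demand[of l]
    unfolding flow_def by (auto simp: links_def)
qed

lemma free_density_consistent:
  assumes G: "parallel_network G" and \<Phi>: "\<Phi> > 0" and R: "R \<in> routing_vectors G"
    and le: "\<And>p. p \<in> routes G \<Longrightarrow> \<Phi> * R p \<le> route_capacity G p"
  shows "free_density G \<Phi> R \<in> consistent G \<Phi> R"
proof -
  have "\<Phi> * R p / free_speed G p l \<ge> 0" if "p \<in> routes G" "l \<in> links G p" for p l
    using link_facts(2)[OF G that] R \<Phi> that by (auto simp: routing_vectors_def PiE_def Pi_def)
  hence "free_density G \<Phi> R \<in> density_vectors G"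
    unfolding density_vectors_def free_density_def by (auto intro!: restrict_PiE)
  moreover have "flow G \<Phi> R (free_density G \<Phi> R) p l = flow G \<Phi> R (free_density G \<Phi> R) p 0"
    if "p \<in> routes G" "l \<in> links G p" for p l
    using free_density_flow[of G p \<Phi> R, OF G that(1) le[OF that(1)]] that(2) by (simp add: links_def)
  ultimately show ?thesis unfolding consistent_def by simp
qed

lemma free_density_route_time:
  assumes G: "parallel_network G" and p: "p \<in> routes G" and le: "\<Phi> * R p \<le> route_capacity G p"
  shows "route_time G \<Phi> R (free_density G \<Phi> R) p = free_flow_time G p"
  unfolding route_time_def free_flow_time_def link_time_def
proof (intro sum.cong refl)
  fix l assume l: "l \<in> links G p"
  have "flow G \<Phi> R (free_density G \<Phi> R) p l = \<Phi> * R p"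
    using free_density_flow[of G p \<Phi> R l, OF G p le] l by (simp add: links_def)
  moreover have "free_density G \<Phi> R p l = \<Phi> * R p / free_speed G p l"
    using p l by (simp add: free_density_def)
  \<comment> \<open>Zero flow gives zero density and the default value; otherwise the flow cancels
    in the quotient.\<close>
  ultimately show "(if free_density G \<Phi> R p l = 0 then link_length G p l / free_speed G p l
      else link_length G p l * free_density G \<Phi> R p l / flow G \<Phi> R (free_density G \<Phi> R) p l)
      = link_length G p l / free_speed G p l"
    by auto
qed

lemma density_eq_free_density:
  assumes "x \<in> density_vectors G"
    and "\<And>p l. p \<in> routes G \<Longrightarrow> l \<in> links G p \<Longrightarrow> x p l = \<Phi> * R p / free_speed G p l"
  shows "x = free_density G \<Phi> R"
proof (rule ext)+
  fix p l
  show "x p l = free_density G \<Phi> R p l"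
    using assms unfolding density_vectors_def free_density_def
    by (cases "p \<in> routes G"; cases "l \<in> links G p") (auto simp: PiE_def Pi_def extensional_def)
qed

section \<open>The linear program solved by greedy filling\<close>

text \<open>As \<open>y\<close> and \<open>g\<close> have the same sum, all times may be shifted by \<open>t k\<close>; then every summand of
  the cost difference is nonnegative.\<close>

lemma greedy_optimal:
  fixes y g t :: "nat \<Rightarrow> real"
  assumes fin: "finite A" and k: "k \<in> A" and t: "strict_mono_on A t"
    and sum: "sum y A = sum g A"
    and below: "\<And>p. p \<in> A \<Longrightarrow> p < k \<Longrightarrow> y p \<le> g p"
    and above: "\<And>p. p \<in> A \<Longrightarrow> p > k \<Longrightarrow> g p \<le> y p"
  shows "(\<Sum>p\<in>A. g p * t p) \<le> (\<Sum>p\<in>A. y p * t p)"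
    and "(\<Sum>p\<in>A. y p * t p) \<le> (\<Sum>p\<in>A. g p * t p) \<Longrightarrow> p \<in> A \<Longrightarrow> y p = g p"
proof -
  define d where "d p = (y p - g p) * (t p - t k)" for p
  have d: "d p \<ge> 0" "d p = 0 \<Longrightarrow> p \<noteq> k \<Longrightarrow> y p = g p" if p: "p \<in> A" for p
  proof -
    consider "p < k" "t p < t k" | "p = k" | "p > k" "t k < t p"
      using strict_mono_onD[OF t] p k by (metis linorder_neqE_nat)
    thus "d p \<ge> 0" "d p = 0 \<Longrightarrow> p \<noteq> k \<Longrightarrow> y p = g p"
      using below[OF p] above[OF p] unfolding d_def
      by (cases; auto intro: mult_nonneg_nonneg mult_nonpos_nonpos)+
  qed
  have "sum d A = (\<Sum>p\<in>A. y p * t p) - (\<Sum>p\<in>A. g p * t p) - (sum y A - sum g A) * t k"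
    unfolding d_def by (simp add: algebra_simps sum.distrib sum_subtractf sum_distrib_left)
  hence sum_d: "sum d A = (\<Sum>p\<in>A. y p * t p) - (\<Sum>p\<in>A. g p * t p)" using sum by simp
  have "sum d A \<ge> 0" by (intro sum_nonneg d)
  thus "(\<Sum>p\<in>A. g p * t p) \<le> (\<Sum>p\<in>A. y p * t p)" using sum_d by simp
  show "y p = g p" if le: "(\<Sum>p\<in>A. y p * t p) \<le> (\<Sum>p\<in>A. g p * t p)" and p: "p \<in> A"
  proof -
    have "sum d A = 0" using le sum_d \<open>sum d A \<ge> 0\<close> by simp
    hence "\<forall>q\<in>A. d q = 0" using sum_nonneg_eq_0_iff[OF fin] d(1) by blast
    \<comment> \<open>Off \<open>k\<close> the factor \<open>t q - t k\<close> is nonzero. At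
      \<open>k\<close> it vanishes, and the value there is recovered from the equal sums.\<close>
    hence off: "y q = g q" if "q \<in> A" "q \<noteq> k" for q using d(2) that by blast
    hence "sum y (A - {k}) = sum g (A - {k})" by (intro sum.cong) auto
    hence "y k = g k" using sum sum.remove[OF fin k, of y] sum.remove[OF fin k, of g] by simp
    thus ?thesis using off p by blast
  qed
qed

text \<open>This describes the flows \<open>\<Phi> * R p\<close> rather than the routing ratios, so
  that it compares directly with route capacities. The parameter \<open>k\<close> is arbitrary here;
  \<open>greedy_flow_feasible\<close> ties it to the partial sums.\<close>

definition greedy_flow :: "network \<Rightarrow> real \<Rightarrow> nat \<Rightarrow> nat \<Rightarrow> real" where
  "greedy_flow G \<Phi> k p =
     (if p < k then route_capacity G p
      else if p = k then \<Phi> - (\<Sum>i = 1..<k. route_capacity G i) else 0)"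

text \<open>The only delicate value is the remainder on route \<open>k\<close>: membership of
  \<open>k\<close> in the set bounds it by the capacity, and minimality of \<open>k\<close> makes it
  nonnegative.\<close>

lemma greedy_flow_feasible:
  assumes G: "parallel_network G" and \<Phi>: "\<Phi> > 0" and feas: "feasible_demand G \<Phi>"
    and k: "k = Min {p \<in> routes G. \<Phi> - (\<Sum>i = 1..p. route_capacity G i) \<le> 0}"
  shows "k \<in> routes G"
    and "p \<in> routes G \<Longrightarrow> 0 \<le> greedy_flow G \<Phi> k p"
    and "p \<in> routes G \<Longrightarrow> greedy_flow G \<Phi> k p \<le> route_capacity G p"
    and "(\<Sum>p\<in>routes G. greedy_flow G \<Phi> k p) = \<Phi>"
proof -
  let ?S = "{p \<in> routes G. \<Phi> - (\<Sum>i = 1..p. route_capacity G i) \<le> 0}"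
  have fin: "finite ?S" by (simp add: routes_def)
  \<comment> \<open>Feasible demand makes the set nonempty, so its \<open>Min\<close> is
    meaningful.\<close>
  have "n_routes G \<in> ?S"
    using G feas unfolding parallel_network_def feasible_demand_def routes_def by auto
  hence kS: "k \<in> ?S" unfolding k using fin Min_in by blast
  thus kr: "k \<in> routes G" by simp
  hence k1: "1 \<le> k" "k \<le> n_routes G" by (auto simp: routes_def)
  have "{1..k} = insert k {1..<k}" using k1 by auto
  hence upper: "\<Phi> - (\<Sum>i = 1..<k. route_capacity G i) \<le> route_capacity G k" using kS by simp
  have lower: "0 \<le> \<Phi> - (\<Sum>i = 1..<k. route_capacity G i)"
  \<comment> \<open>For \<open>k = 1\<close> the predecessor 0 is not a route, so minimality says
    nothing; the remainder is then \<open>\<Phi>\<close> itself.\<close>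
  proof (cases "k = 1")
    case True
    thus ?thesis using \<Phi> by simp
  next
    case False
    have "k - 1 \<notin> ?S" using Min_le[OF fin, of "k - 1"] k k1 by auto
    moreover have "k - 1 \<in> routes G" "{1..k - 1} = {1..<k}" using False k1 by (auto simp: routes_def)
    ultimately show ?thesis by simp
  qed
  show "0 \<le> greedy_flow G \<Phi> k p" if "p \<in> routes G"
    using lower route_capacity_pos[OF G that] unfolding greedy_flow_def by auto
  show "greedy_flow G \<Phi> k p \<le> route_capacity G p" if "p \<in> routes G"
    using upper route_capacity_pos[OF G that] unfolding greedy_flow_def by auto
  have "(\<Sum>p\<in>routes G. greedy_flow G \<Phi> k p) = (\<Sum>p = 1..k. greedy_flow G \<Phi> k p)"
    using k1 by (intro sum.mono_neutral_right) (auto simp: routes_def greedy_flow_def)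
  also have "\<dots> = greedy_flow G \<Phi> k k + (\<Sum>p = 1..<k. greedy_flow G \<Phi> k p)"
    using \<open>{1..k} = insert k {1..<k}\<close> by simp
  also have "\<dots> = \<Phi>" by (simp add: greedy_flow_def)
  finally show "(\<Sum>p\<in>routes G. greedy_flow G \<Phi> k p) = \<Phi>" .
qed

section \<open>The unique social optimum\<close>

theorem proposition2:
  fixes G :: network and \<Phi> :: real and k :: nat
  assumes "parallel_network G"
    and "\<Phi> > 0"
    and "unique_bottlenecks G"
    and "feasible_demand G \<Phi>"
    and "distinct_times G"
    and "k = Min {p \<in> routes G. \<Phi> - (\<Sum>i = 1..p. route_capacity G i) \<le> 0}"
  shows "(\<exists>!(R, x). social_optimum G \<Phi> (R, x)) \<and>
    (\<forall>R x. social_optimum G \<Phi> (R, x) \<longrightarrow>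
      (\<forall>p\<in>routes G. \<Phi> * R p =
         (if p < k then route_capacity G p
          else if p = k then \<Phi> - (\<Sum>i = 1..<k. route_capacity G i)
          else 0)) \<and>
      (\<forall>p\<in>routes G. \<forall>l\<in>links G p. x p l =
         (if p < k then route_capacity G p / free_speed G p l
          else if p = k
          then (\<Phi> - (\<Sum>i = 1..<k. route_capacity G i)) / free_speed G p l
          else 0)))"
proof -
  note G = assms(1) and \<Phi> = assms(2)
  note gf = greedy_flow_feasible[OF assms(1,2,4,6)]
  let ?g = "greedy_flow G \<Phi> k" and ?t = "free_flow_time G"
  define R0 where "R0 = (\<lambda>p\<in>routes G. ?g p / \<Phi>)"
  define x0 where "x0 = free_density G \<Phi> R0"
  have R0: "\<Phi> * R0 p = ?g p" if "p \<in> routes G" for p using that \<Phi> by (simp add: R0_def)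
  have "(\<Sum>p\<in>routes G. R0 p) = (\<Sum>p\<in>routes G. ?g p) / \<Phi>"
    unfolding sum_divide_distrib by (intro sum.cong) (auto simp: R0_def)
  hence R0_vec: "R0 \<in> routing_vectors G"
    using gf(2,4) \<Phi> unfolding routing_vectors_def by (auto simp: R0_def)
  have le0: "\<Phi> * R0 p \<le> route_capacity G p" if "p \<in> routes G" for p
    using that R0 gf(3) by simp
  have adm0: "(R0, x0) \<in> admissible_assignments G \<Phi>"
    unfolding admissible_assignments_def traffic_assignments_def x0_def
    using R0_vec le0 free_density_consistent[OF G \<Phi> R0_vec le0] by auto
  have cost0: "social_cost G \<Phi> (R0, x0) = (\<Sum>p\<in>routes G. ?g p * ?t p)"
    unfolding social_cost_def x0_def
    by (simp add: free_density_route_time[OF G _ le0] R0 cong: sum.cong)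
  have optimal: "social_cost G \<Phi> (R0, x0) \<le> social_cost G \<Phi> (R, x)"
    and unique: "social_cost G \<Phi> (R, x) \<le> social_cost G \<Phi> (R0, x0) \<Longrightarrow> R = R0 \<and> x = x0"
    if adm: "(R, x) \<in> admissible_assignments G \<Phi>" for R x
  proof -
    have R: "R \<in> routing_vectors G" and x: "x \<in> consistent G \<Phi> R"
      and le: "\<And>p. p \<in> routes G \<Longrightarrow> \<Phi> * R p \<le> route_capacity G p"
      using adm by (auto simp: admissible_assignments_def traffic_assignments_def)
    have nonneg: "\<And>p. p \<in> routes G \<Longrightarrow> R p \<ge> 0" and "sum R (routes G) = 1"
      and ext: "R \<in> extensional (routes G)"
      using R by (auto simp: routing_vectors_def PiE_def Pi_def)
    \<comment> \<open>The ratios sum to 1, so both flow vectors have total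
      \<open>\<Phi>\<close>.\<close>
    hence sum: "(\<Sum>p\<in>routes G. \<Phi> * R p) = sum ?g (routes G)"
      using gf(4) by (simp flip: sum_distrib_left)
    have mono: "strict_mono_on (routes G) ?t" using assms(5) by (simp add: distinct_times_def)
    have below: "\<Phi> * R p \<le> ?g p" if "p \<in> routes G" "p < k" for p
      using le that by (simp add: greedy_flow_def)
    have above: "?g p \<le> \<Phi> * R p" if "p \<in> routes G" "p > k" for p
      using nonneg \<Phi> that by (simp add: greedy_flow_def)
    have fin: "finite (routes G)" by (simp add: routes_def)
    have greedy: "(\<Sum>p\<in>routes G. ?g p * ?t p) \<le> (\<Sum>p\<in>routes G. \<Phi> * R p * ?t p)"
      by (rule greedy_optimal(1)[OF fin gf(1) mono sum]) (simp_all add: below above)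
    have route: "\<Phi> * R p * ?t p \<le> \<Phi> * R p * route_time G \<Phi> R x p" if "p \<in> routes G" for p
      using route_cost_ge[OF G x that le[OF that]] nonneg[OF that] \<Phi> by simp
    have free: "(\<Sum>p\<in>routes G. \<Phi> * R p * ?t p) \<le> social_cost G \<Phi> (R, x)"
      unfolding social_cost_def by (simp add: sum_mono route)
    show "social_cost G \<Phi> (R0, x0) \<le> social_cost G \<Phi> (R, x)"
      using free greedy cost0 by simp
    \<comment> \<open>This closes the chain greedy cost, free-flow cost of \<open>R\<close>, actual
      cost of \<open>(R, x)\<close>. Equality in the first link fixes \<open>R\<close>, and equality
      in the second fixes \<open>x\<close>.\<close>
    assume opt: "social_cost G \<Phi> (R, x) \<le> social_cost G \<Phi> (R0, x0)"
    have "\<Phi> * R p = ?g p" if "p \<in> routes G" for p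
      by (rule greedy_optimal(2)[OF fin gf(1) mono sum])
        (use free opt cost0 that in \<open>simp_all add: below above\<close>)
    hence "R p = R0 p" if "p \<in> routes G" for p using that R0 \<Phi> by (metis mult_left_cancel less_irrefl)
    hence RR0: "R = R0"
      using ext R0_vec by (intro extensionalityI[of _ "routes G"]) (auto simp: routing_vectors_def PiE_def)
    have "(\<Sum>p\<in>routes G. \<Phi> * R p * ?t p) = (\<Sum>p\<in>routes G. \<Phi> * R p * route_time G \<Phi> R x p)"
      using free greedy opt cost0 unfolding social_cost_def by simp
    hence eq: "\<Phi> * R p * ?t p = \<Phi> * R p * route_time G \<Phi> R x p" if "p \<in> routes G" for p
      by (rule sum_mono_inv) (use route that fin in auto)
    have "x = free_density G \<Phi> R"
    proof (rule density_eq_free_density)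
      show "x \<in> density_vectors G" using x by (simp add: consistent_def)
      show "x p l = \<Phi> * R p / free_speed G p l" if "p \<in> routes G" "l \<in> links G p" for p l
        by (rule route_cost_eqD[OF G x that(1) le[OF that(1)] nonneg[OF that(1)] \<Phi>
              eq[OF that(1), symmetric] that(2)])
    qed
    thus "R = R0 \<and> x = x0" using RR0 by (simp add: x0_def)
  qed
  \<comment> \<open>The explicit pair is admissible and minimal, and no other admissible pair is as
    cheap, so being optimal means being this pair.\<close>
  have opt_iff: "social_optimum G \<Phi> (R, x) \<longleftrightarrow> R = R0 \<and> x = x0" for R x
    unfolding social_optimum_def is_arg_min_linorder using adm0 optimal unique by auto
  have x0: "x0 p l = ?g p / free_speed G p l" if "p \<in> routes G" "l \<in> links G p" for p l
    using that R0 by (simp add: x0_def free_density_def)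
  have "\<exists>!(R, x). social_optimum G \<Phi> (R, x)" unfolding opt_iff by auto
  thus ?thesis using R0 x0 unfolding opt_iff greedy_flow_def by auto
qed

end
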